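(* Let $\varepsilon>0$ and $\boldsymbol\theta\in\mathbb{R}^{K\times N}$. For any $\delta>0$, \[ \Phi_\varepsilon^G(\boldsymbol\theta)>-\delta\quad\Longrightarrow\quad{\rm Err}^G(\boldsymbol\theta)<\frac{\delta}{\log 2}. \] In particular, if $\delta<\frac{\log 2}{|\Omega|}$, then $\Phi_\varepsilon^G(\boldsymbol\theta)>-\delta$ implies ${\rm Err}^G(\boldsymbol\theta)=0$, i.e. $F_{\boldsymbol\theta}(x)=G(x)$ for all $x\in\Omega$.
   Context: Let $\overline\Omega=[-1,1]^2$ and let $\Omega\subset\overline\Omega$ be a nonempty finite set (of pixels). Let $N>1$ and $K\ge 1$ be integers and $[N]:=\{1,\dots,N\}$. Let $G:\Omega\to[N]$ be a given map (the grain map) and $\eta:\overline\Omega\to\mathbb{R}^K$ a given function (the design function). For $\boldsymbol\theta=(\theta_1,\dots,\theta_N)\in\mathbb{R}^{K\times N}$ with $\theta_i\in\mathbb{R}^K$, set $h_{\theta_i}(x):=\theta_i\cdot\eta(x)$ for $x\in\overline\Omega$. Hard assignment: $F_{\boldsymbol\theta}(x):=\operatorname{arg\,min}_{i\in[N]}h_{\theta_i}(x)$, where if the minimiser is not unique the smallest minimising index is selected. Fraction of misassigned pixels: \[ {\rm Err}^G(\boldsymbol\theta):=\frac{1}{|\Omega|}\Big|\{x\in\Omega:\ F_{\boldsymbol\theta}(x)\neq G(x)\}\Big|. \] Soft assignment, for $\varepsilon>0$: \[ (p_{\boldsymbol\theta}^\varepsilon)_i(x):=\frac{\exp\left(-\frac1\varepsilon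 h_{\theta_i}(x)\right)}{\sum_{j=1}^N\exp\left(-\frac1\varepsilon h_{\theta_j}(x)\right)},\qquad i\in[N]. \] Objective function, for $\varepsilon>0$: \[ \Phi_\varepsilon^G(\boldsymbol\theta):=\frac{1}{|\Omega|}\sum_{x\in\Omega}\log\big((p_{\boldsymbol\theta}^\varepsilon)_{G(x)}(x)\big). \] *)

theory Defs
  imports "HOL-Analysis.Analysis"
begin

text \<open>
  The index set \<open>[N]\<close> is \<open>{1..N}\<close>, and \<open>K\<close> is the cardinality of the finite index type \<open>'k\<close>
  (so \<open>K \<ge> 1\<close> holds automatically). A parameter is a family of vectors indexed by natural
  numbers, of which only the members with index in \<open>{1..N}\<close> enter the definitions below;
  likewise, the design function and the grain map are total functions whose values outside
  \<open>domain_box\<close> and outside the pixel set, respectively, are never used in the theorem.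
\<close>

type_synonym point = "real \<times> real"

definition domain_box :: "point set" where
  "domain_box = {-1..1} \<times> {-1..1}"

definition score :: "(point \<Rightarrow> real ^ 'k) \<Rightarrow> real ^ 'k \<Rightarrow> point \<Rightarrow> real" where
  "score \<eta> t x = t \<bullet> \<eta> x"

text \<open>\<open>LEAST\<close> implements the tie-breaking rule: the smallest minimising index is selected.\<close>

definition hard_assign ::
    "nat \<Rightarrow> (point \<Rightarrow> real ^ 'k) \<Rightarrow> (nat \<Rightarrow> real ^ 'k) \<Rightarrow> point \<Rightarrow> nat" where
  "hard_assign N \<eta> \<theta> x =
     (LEAST i. is_arg_min (\<lambda>j. score \<eta> (\<theta> j) x) (\<lambda>j. j \<in> {1..N}) i)"

definition misassigned_fraction ::
    "nat \<Rightarrow> point set \<Rightarrow> (point \<Rightarrow> real ^ 'k) \<Rightarrow> (point \<Rightarrow> nat) \<Rightarrow> (nat \<Rightarrow> real ^ 'k) \<Rightarrow> real" where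
  "misassigned_fraction N \<Omega> \<eta> G \<theta> =
     1 / real (card \<Omega>) * real (card {x \<in> \<Omega>. hard_assign N \<eta> \<theta> x \<noteq> G x})"

definition soft_assign ::
    "nat \<Rightarrow> (point \<Rightarrow> real ^ 'k) \<Rightarrow> real \<Rightarrow> (nat \<Rightarrow> real ^ 'k) \<Rightarrow> nat \<Rightarrow> point \<Rightarrow> real" where
  "soft_assign N \<eta> \<epsilon> \<theta> i x =
     exp (- (1 / \<epsilon>) * score \<eta> (\<theta> i) x) / (\<Sum>j\<in>{1..N}. exp (- (1 / \<epsilon>) * score \<eta> (\<theta> j) x))"

definition objective ::
    "nat \<Rightarrow> point set \<Rightarrow> (point \<Rightarrow> real ^ 'k) \<Rightarrow> (point \<Rightarrow> nat) \<Rightarrow> real \<Rightarrow> (nat \<Rightarrow> real ^ 'k) \<Rightarrow> real" where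
  "objective N \<Omega> \<eta> G \<epsilon> \<theta> =
     1 / real (card \<Omega>) * (\<Sum>x\<in>\<Omega>. ln (soft_assign N \<eta> \<epsilon> \<theta> (G x) x))"

end

theory Submission
  imports Defs
begin

text \<open>
  A misassigned pixel costs the objective at least \<open>ln 2\<close>. If the hard assignment of \<open>x\<close> differs
  from \<open>G x\<close>, then some label other than \<open>G x\<close> has a score at most that of \<open>G x\<close>, hence a soft
  probability at least as large; as the two probabilities sum to at most \<open>1\<close>, that of \<open>G x\<close> is at
  most \<open>1 / 2\<close> (\<open>soft_assign_le_half\<close>). All other pixels contribute \<open>ln p \<le> 0\<close>. Averaging gives
  \<open>objective \<le> - ln 2 * misassigned_fraction\<close> (\<open>objective_le\<close>), which is the first claim. The
  second follows because the fraction is an integer multiple of \<open>1 / card \<Omega>\<close>: below that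
  value it can only be \<open>0\<close>.
\<close>

lemma hard_assign_is_arg_min:
  assumes "N \<ge> 1"
  shows "is_arg_min (\<lambda>j. score \<eta> (\<theta> j) x) (\<lambda>j. j \<in> {1..N}) (hard_assign N \<eta> \<theta> x)"
  unfolding hard_assign_def
  by (rule LeastI_ex, rule ex_is_arg_min_if_finite) (use assms in auto)

lemma soft_assign_pos:
  assumes "N \<ge> 1"
  shows "soft_assign N \<eta> \<epsilon> \<theta> i x > 0"
  unfolding soft_assign_def using assms by (intro divide_pos_pos sum_pos) auto

lemma sum_soft_assign:
  assumes "N \<ge> 1"
  shows "(\<Sum>i\<in>{1..N}. soft_assign N \<eta> \<epsilon> \<theta> i x) = 1"
proof -
  have "(\<Sum>j\<in>{1..N}. exp (- (1 / \<epsilon>) * score \<eta> (\<theta> j) x)) > 0"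
    using assms by (intro sum_pos) auto
  then show ?thesis
    unfolding soft_assign_def by (simp flip: sum_divide_distrib)
qed

lemma soft_assign_antimono:
  assumes "\<epsilon> > 0" and "score \<eta> (\<theta> i) x \<le> score \<eta> (\<theta> j) x"
  shows "soft_assign N \<eta> \<epsilon> \<theta> j x \<le> soft_assign N \<eta> \<epsilon> \<theta> i x"
  unfolding soft_assign_def using assms
  by (intro divide_right_mono sum_nonneg) (auto intro: divide_right_mono)

lemma soft_assign_add_le_1:
  assumes "i \<in> {1..N}" and "j \<in> {1..N}" and "i \<noteq> j"
  shows "soft_assign N \<eta> \<epsilon> \<theta> i x + soft_assign N \<eta> \<epsilon> \<theta> j x \<le> 1"
proof -
  have N: "N \<ge> 1" using assms by auto
  have "(\<Sum>k\<in>{i, j}. soft_assign N \<eta> \<epsilon> \<theta> k x) \<le> (\<Sum>k\<in>{1..N}. soft_assign N \<eta> \<epsilon> \<theta> k x)"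
    using assms by (intro sum_mono2 less_imp_le[OF soft_assign_pos[OF N]]) auto
  then show ?thesis
    using assms by (simp only: sum_soft_assign[OF N]) simp
qed

lemma soft_assign_le_1:
  assumes "i \<in> {1..N}"
  shows "soft_assign N \<eta> \<epsilon> \<theta> i x \<le> 1"
proof -
  have N: "N \<ge> 1" using assms by auto
  have "soft_assign N \<eta> \<epsilon> \<theta> i x \<le> (\<Sum>k\<in>{1..N}. soft_assign N \<eta> \<epsilon> \<theta> k x)"
    using assms by (intro member_le_sum less_imp_le[OF soft_assign_pos[OF N]]) auto
  then show ?thesis
    by (simp only: sum_soft_assign[OF N])
qed

text \<open>
  The label chosen by the hard assignment has a score at most that of \<open>i\<close>, so it is at least as
  probable as \<open>i\<close>; together the two have probability at most \<open>1\<close>. If \<open>i\<close> is itself a minimiser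
  that lost the tie-break, the two are equally probable and the bound still holds.
\<close>

lemma soft_assign_le_half:
  assumes "\<epsilon> > 0" and "i \<in> {1..N}" and "hard_assign N \<eta> \<theta> x \<noteq> i"
  shows "soft_assign N \<eta> \<epsilon> \<theta> i x \<le> 1 / 2"
proof -
  define m where "m = hard_assign N \<eta> \<theta> x"
  have "is_arg_min (\<lambda>j. score \<eta> (\<theta> j) x) (\<lambda>j. j \<in> {1..N}) m"
    unfolding m_def by (rule hard_assign_is_arg_min) (use assms(2) in auto)
  then have m: "m \<in> {1..N}" and le: "score \<eta> (\<theta> m) x \<le> score \<eta> (\<theta> i) x"
    using assms(2) by (auto simp: is_arg_min_linorder)
  have "soft_assign N \<eta> \<epsilon> \<theta> i x \<le> soft_assign N \<eta> \<epsilon> \<theta> m x"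
    using assms(1) le by (rule soft_assign_antimono)
  moreover have "soft_assign N \<eta> \<epsilon> \<theta> i x + soft_assign N \<eta> \<epsilon> \<theta> m x \<le> 1"
    using assms m by (intro soft_assign_add_le_1) (auto simp: m_def)
  ultimately show ?thesis by linarith
qed

lemma ln_soft_assign_le:
  assumes "\<epsilon> > 0" and "i \<in> {1..N}"
  shows "ln (soft_assign N \<eta> \<epsilon> \<theta> i x) \<le> (if hard_assign N \<eta> \<theta> x \<noteq> i then - ln 2 else 0)"
proof -
  have pos: "soft_assign N \<eta> \<epsilon> \<theta> i x > 0"
    by (rule soft_assign_pos) (use assms(2) in auto)
  show ?thesis
  proof (cases "hard_assign N \<eta> \<theta> x = i")
    case True
    then show ?thesis using pos soft_assign_le_1[OF assms(2)] by simp
  next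
    case False
    have "ln (soft_assign N \<eta> \<epsilon> \<theta> i x) \<le> ln (1 / 2)"
      using pos soft_assign_le_half[OF assms False] by (subst ln_le_cancel_iff) auto
    then show ?thesis using False by (simp add: ln_div)
  qed
qed

lemma objective_le:
  assumes "finite \<Omega>" and "G \<in> \<Omega> \<rightarrow> {1..N}" and "\<epsilon> > 0"
  shows "objective N \<Omega> \<eta> G \<epsilon> \<theta> \<le> - ln 2 * misassigned_fraction N \<Omega> \<eta> G \<theta>"
proof -
  have "(\<Sum>x\<in>\<Omega>. ln (soft_assign N \<eta> \<epsilon> \<theta> (G x) x))
      \<le> (\<Sum>x\<in>\<Omega>. if hard_assign N \<eta> \<theta> x \<noteq> G x then - ln 2 else 0)"
    using assms by (intro sum_mono ln_soft_assign_le) auto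
  also have "\<dots> = (\<Sum>x\<in>{x \<in> \<Omega>. hard_assign N \<eta> \<theta> x \<noteq> G x}. - ln 2)"
    using assms(1) by (rule sum.inter_filter[symmetric])
  also have "\<dots> = - ln 2 * real (card {x \<in> \<Omega>. hard_assign N \<eta> \<theta> x \<noteq> G x})"
    by simp
  finally have "1 / real (card \<Omega>) * (\<Sum>x\<in>\<Omega>. ln (soft_assign N \<eta> \<epsilon> \<theta> (G x) x))
      \<le> 1 / real (card \<Omega>) * (- ln 2 * real (card {x \<in> \<Omega>. hard_assign N \<eta> \<theta> x \<noteq> G x}))"
    by (rule mult_left_mono) simp
  then show ?thesis
    unfolding objective_def misassigned_fraction_def by (simp add: mult.commute)
qed

lemma misassigned_fraction_less_inverse_card:
  assumes "finite \<Omega>" and "misassigned_fraction N \<Omega> \<eta> G \<theta> < 1 / real (card \<Omega>)"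
  shows "\<forall>x\<in>\<Omega>. hard_assign N \<eta> \<theta> x = G x"
proof -
  have "card {x \<in> \<Omega>. hard_assign N \<eta> \<theta> x \<noteq> G x} < 1"
    using assms(2) unfolding misassigned_fraction_def
    by (cases "card \<Omega> = 0") (auto simp: field_simps)
  then show ?thesis using assms(1) by auto
qed

theorem corollary4p10:
  fixes N :: nat
    and \<Omega> :: "(real \<times> real) set"
    and G :: "real \<times> real \<Rightarrow> nat"
    and \<eta> :: "real \<times> real \<Rightarrow> real ^ 'k"
    and \<theta> :: "nat \<Rightarrow> real ^ 'k"
    and \<epsilon> :: real
  assumes "N > 1"
    and "\<Omega> \<subseteq> domain_box" and "finite \<Omega>" and "\<Omega> \<noteq> {}"
    and "G \<in> \<Omega> \<rightarrow> {1..N}"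
    and "\<epsilon> > 0"
  shows "\<forall>\<delta>>0.
    (objective N \<Omega> \<eta> G \<epsilon> \<theta> > - \<delta> \<longrightarrow> misassigned_fraction N \<Omega> \<eta> G \<theta> < \<delta> / ln 2) \<and>
    (\<delta> < ln 2 / real (card \<Omega>) \<longrightarrow> objective N \<Omega> \<eta> G \<epsilon> \<theta> > - \<delta> \<longrightarrow>
       misassigned_fraction N \<Omega> \<eta> G \<theta> = 0 \<and> (\<forall>x\<in>\<Omega>. hard_assign N \<eta> \<theta> x = G x))"
proof (intro allI impI conjI)
  fix \<delta> :: real
  assume obj: "objective N \<Omega> \<eta> G \<epsilon> \<theta> > - \<delta>"
  have "- \<delta> < - ln 2 * misassigned_fraction N \<Omega> \<eta> G \<theta>"
    using obj objective_le[OF assms(3,5,6)] by (rule less_le_trans)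
  then show err: "misassigned_fraction N \<Omega> \<eta> G \<theta> < \<delta> / ln 2"
    by (simp add: field_simps)
  assume "\<delta> < ln 2 / real (card \<Omega>)"
  then have "\<delta> / ln 2 < 1 / real (card \<Omega>)"
    by (simp add: field_simps)
  with err have "misassigned_fraction N \<Omega> \<eta> G \<theta> < 1 / real (card \<Omega>)"
    by (rule less_trans)
  with assms(3) show "\<forall>x\<in>\<Omega>. hard_assign N \<eta> \<theta> x = G x"
    by (rule misassigned_fraction_less_inverse_card)
  then have "{x \<in> \<Omega>. hard_assign N \<eta> \<theta> x \<noteq> G x} = {}"
    by blast
  then show "misassigned_fraction N \<Omega> \<eta> G \<theta> = 0"
    unfolding misassigned_fraction_def by (simp only: card.empty of_nat_0 mult_zero_right)
qed

end
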